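(* Let $\lambda$ be a JS-partition of type $\alpha\in\{0,\dots,p-1\}$ with $l$ parts, and let $r\in\{0,\dots,p-1\}$ with $l\equiv r\pmod p$. Then the $p$-core of $\lambda$ is $$\lambda_{(p)}=\begin{cases}((\alpha+s)^s)\ \text{with } s=r & \text{if } r\le\frac{p-\alpha}{2},\\ ((\alpha+s)^s)\ \text{with } s=(p-\alpha)-r & \text{if } \frac{p-\alpha}{2}<r\le p-\alpha,\\ (s^{p-\alpha+s})\ \text{with } s=r-(p-\alpha) & \text{if } p-\alpha<r\le p-\frac{\alpha}{2},\\ (s^{p-\alpha+s})\ \text{with } s=p-r & \text{if } p-\frac{\alpha}{2}<r<p,\end{cases}$$ where $(c^0)$ and $(0^b)$ denote the empty partition.
   Context: Fix an integer $p\ge 2$. A partition is written $\lambda=(l_1^{a_1},\dots,l_t^{a_t})$ with $l_1>\dots>l_t>0$, $a_i\ge1$; $(c^b)$ denotes the partition with $b$ parts all equal to $c$. It is $p$-regular if all $a_i\le p-1$. A $p$-regular $\lambda$ is a JS-partition if $l_i-l_{i+1}+a_i+a_{i+1}\equiv 0\pmod p$ for $1\le i<t$; its type is $l_1-a_1 \bmod p$. The $p$-core $\lambda_{(p)}$ is obtained from $\lambda$ by repeatedly removing rim hooks of length $p$ until none remains. *)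

theory Defs
  imports Complex_Main "HOL-Number_Theory.Cong"
begin

text \<open>A partition is the weakly decreasing list of its positive parts.\<close>

definition is_partition :: "nat list \<Rightarrow> bool" where
  "is_partition lam \<longleftrightarrow> sorted_wrt (\<ge>) lam \<and> 0 \<notin> set lam"

definition rect_partition :: "nat \<Rightarrow> nat \<Rightarrow> nat list" where
  "rect_partition c b = (if c = 0 then [] else replicate b c)"

text \<open>
  In exponential notation the list \<open>lam\<close> is \<open>(l\<^sub>1^{a\<^sub>1}, ..., l\<^sub>t^{a\<^sub>t})\<close>, where
  \<open>l\<^sub>1 > ... > l\<^sub>t\<close> are the entries of \<open>remdups lam\<close> (which keeps the decreasing
  order) and \<open>a\<^sub>i\<close> is the multiplicity of \<open>l\<^sub>i\<close>.
\<close>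

abbreviation distinct_parts :: "nat list \<Rightarrow> nat list" where
  "distinct_parts lam \<equiv> remdups lam"

abbreviation part_mult :: "nat list \<Rightarrow> nat \<Rightarrow> nat" where
  "part_mult lam x \<equiv> count_list lam x"

definition p_regular :: "nat \<Rightarrow> nat list \<Rightarrow> bool" where
  "p_regular p lam \<longleftrightarrow> is_partition lam \<and> (\<forall>x\<in>set lam. part_mult lam x \<le> p - 1)"

definition js_partition :: "nat \<Rightarrow> nat list \<Rightarrow> bool" where
  "js_partition p lam \<longleftrightarrow> p_regular p lam \<and>
     (\<forall>i. Suc i < length (distinct_parts lam) \<longrightarrow>
        (let x = distinct_parts lam ! i; y = distinct_parts lam ! Suc i in
           [int x - int y + int (part_mult lam x) + int (part_mult lam y) = 0] (mod int p)))"

text \<open>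
  The type is \<open>l\<^sub>1 - a\<^sub>1\<close> modulo \<open>p\<close>, computed in the integers.  For the empty partition
  we use the convention \<open>l\<^sub>1 = a\<^sub>1 = 0\<close>.
\<close>

definition js_type :: "nat \<Rightarrow> nat list \<Rightarrow> nat" where
  "js_type p lam =
     (if lam = [] then 0 else nat ((int (hd lam) - int (part_mult lam (hd lam))) mod int p))"

definition young_diagram :: "nat list \<Rightarrow> (nat \<times> nat) set" where
  "young_diagram lam = {(i, j). i < length lam \<and> j < lam ! i}"

definition rim :: "nat list \<Rightarrow> (nat \<times> nat) set" where
  "rim lam = {(i, j) \<in> young_diagram lam. (Suc i, Suc j) \<notin> young_diagram lam}"

definition cell_adjacent :: "nat \<times> nat \<Rightarrow> nat \<times> nat \<Rightarrow> bool" where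
  "cell_adjacent x y \<longleftrightarrow>
     (fst x = fst y \<and> (snd y = Suc (snd x) \<or> snd x = Suc (snd y))) \<or>
     (snd x = snd y \<and> (fst y = Suc (fst x) \<or> fst x = Suc (fst y)))"

definition cells_connected :: "(nat \<times> nat) set \<Rightarrow> bool" where
  "cells_connected R \<longleftrightarrow>
     (\<forall>x\<in>R. \<forall>y\<in>R. (\<lambda>u v. u \<in> R \<and> v \<in> R \<and> cell_adjacent u v)\<^sup>*\<^sup>* x y)"

text \<open>
  \<open>R\<close> is a rim hook of \<open>lam\<close> of length \<open>h\<close>, and deleting it leaves the partition \<open>mu\<close>.
\<close>

definition rim_hook_removal ::
    "nat \<Rightarrow> nat list \<Rightarrow> (nat \<times> nat) set \<Rightarrow> nat list \<Rightarrow> bool" where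
  "rim_hook_removal h lam R mu \<longleftrightarrow>
     is_partition lam \<and> is_partition mu \<and>
     R \<subseteq> rim lam \<and> cells_connected R \<and> card R = h \<and>
     young_diagram mu = young_diagram lam - R"

definition removes_rim_hook :: "nat \<Rightarrow> nat list \<Rightarrow> nat list \<Rightarrow> bool" where
  "removes_rim_hook h lam mu \<longleftrightarrow> (\<exists>R. rim_hook_removal h lam R mu)"

definition is_p_core_of :: "nat \<Rightarrow> nat list \<Rightarrow> nat list \<Rightarrow> bool" where
  "is_p_core_of p lam mu \<longleftrightarrow>
     (removes_rim_hook p)\<^sup>*\<^sup>* lam mu \<and> (\<nexists>nu. removes_rim_hook p mu nu)"

text \<open>
  Well defined for \<open>p \<ge> 1\<close> by the classical fact that the final partition does not depend
  on the choice of the rim hooks removed.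
\<close>

definition p_core :: "nat \<Rightarrow> nat list \<Rightarrow> nat list" where
  "p_core p lam = (THE mu. is_p_core_of p lam mu)"

end

theory Submission imports Defs begin

text \<open>
  Encode a partition by its beta-numbers \<open>\<lambda>\<^sub>i - i - 1\<close> (\<open>i = 0, 1, \<dots>\<close>, padding with zero
  parts). The cells of a rim hook of length \<open>p\<close> have \<open>p\<close> consecutive contents, so deleting it
  lowers the number of cells of each residue by one, and by telescoping along the rows the
  number of beta-numbers in each residue class is unchanged. A partition without rim hooks of
  length \<open>p\<close> has beta-numbers closed under subtracting \<open>p\<close>, and such a set is determined by
  those numbers; hence the core is the only such partition with the right counts.

  For a JS-partition, the congruences say precisely that modulo \<open>p\<close> every block of equal parts
  starts where the preceding block ended. So the \<open>l\<close> beta-numbers are, modulo \<open>p\<close>,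
  \<open>\<alpha>, \<alpha> + 1, \<dots>, \<alpha> + l - 1\<close>. The rectangle \<open>(c\<^sup>b)\<close> claimed in each of the four cases has the same
  counts, and as \<open>b + c \<le> p\<close> its rim has fewer than \<open>p\<close> cells.
\<close>

section \<open>Partitions as functions\<close>

text \<open>Indicator sums must stay sums, so that they can be split and telescoped, rather than
  become cardinalities.\<close>

declare sum_of_bool_eq [simp del]

text \<open>Padding with zero rows makes partitions of different lengths comparable row by
  row.\<close>

definition part :: "nat list \<Rightarrow> nat \<Rightarrow> nat" where
  "part lam i = (if i < length lam then lam ! i else 0)"

lemma young_diagram_part: "young_diagram lam = {(i, j). j < part lam i}"
  by (auto simp: young_diagram_def part_def split: if_splits)

lemma part_eq_0: "length lam \<le> i \<Longrightarrow> part lam i = 0"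
  by (simp add: part_def)

lemma part_antimono:
  assumes "is_partition lam"
  shows "antimono (part lam)"
proof (rule antimonoI)
  fix i j :: nat
  assume "i \<le> j"
  then show "part lam j \<le> part lam i"
    using assms by (cases "i = j") (auto simp: is_partition_def part_def sorted_wrt_iff_nth_less)
qed

lemma part_pos:
  assumes "is_partition lam" "i < length lam"
  shows "part lam i > 0"
  using assms by (metis is_partition_def neq0_conv nth_mem part_def)

lemma partition_eqI:
  assumes "is_partition lam" "is_partition mu" "\<And>i. part lam i = part mu i"
  shows "lam = mu"
proof -
  have "length lam = length mu"
    using assms by (metis linorder_neqE_nat less_irrefl part_eq_0 order_refl part_pos)
  then show ?thesis
    using assms(3) by (intro nth_equalityI) (auto simp: part_def split: if_splits, metis)
qed

text \<open>Cut the function off at its first zero. This turns the row lengths left after deleting a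
  hook back into a list of positive parts.\<close>

lemma ex_partition_of_antimono:
  fixes f :: "nat \<Rightarrow> nat"
  assumes "antimono f" "f n = 0"
  shows "\<exists>mu. is_partition mu \<and> young_diagram mu = {(i, j). j < f i}"
proof -
  define m where "m = (LEAST m. f m = 0)"
  have m0: "f m = 0" unfolding m_def using assms(2) by (rule LeastI)
  have pos: "f k > 0" if "k < m" for k
    using that not_less_Least unfolding m_def by blast
  have zero: "f k = 0" if "k \<ge> m" for k
    using antimonoD[OF assms(1) that] m0 by simp
  have "is_partition (map f [0..<m])"
    using pos antimonoD[OF assms(1)]
    by (fastforce simp: is_partition_def sorted_wrt_iff_nth_less)
  moreover have "young_diagram (map f [0..<m]) = {(i, j). j < f i}"
  proof -
    have "a < m" if "b < f a" for a b
      using that zero[of a] by (cases "a < m") auto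
    then show ?thesis by (auto simp: young_diagram_def)
  qed
  ultimately show ?thesis by blast
qed

lemma young_diagram_Sigma:
  assumes "length lam \<le> N"
  shows "young_diagram lam = (SIGMA i:{..<N}. {..<part lam i})"
  using assms by (auto simp: young_diagram_def part_def split: if_splits)

lemma finite_young_diagram: "finite (young_diagram lam)"
  by (simp add: young_diagram_Sigma[OF order_refl])

section \<open>Contents and beta-numbers\<close>

definition content :: "nat \<times> nat \<Rightarrow> int" where
  "content z = int (snd z) - int (fst z)"

text \<open>For a nonempty row this is the content of its last cell. An empty row gets the content
  of the position just left of it, so full and empty rows follow one formula.\<close>

definition beta :: "nat list \<Rightarrow> nat \<Rightarrow> int" where
  "beta lam i = int (part lam i) - int i - 1"

definition bead_count :: "nat \<Rightarrow> nat list \<Rightarrow> nat \<Rightarrow> int \<Rightarrow> int" where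
  "bead_count p lam N k = (\<Sum>i<N. of_bool (int p dvd beta lam i - k))"

definition content_count :: "nat \<Rightarrow> nat list \<Rightarrow> int \<Rightarrow> int" where
  "content_count p lam k = (\<Sum>z\<in>young_diagram lam. of_bool (int p dvd content z - k))"

text \<open>The contents in row \<open>i\<close> are consecutive, starting at \<open>- i\<close>.
  Hence the difference of the counts for residues \<open>k\<close> and \<open>k + 1\<close>
  telescopes to the two ends of the row: the right end is the beta-number, and the left ends give a
  sum that depends on \<open>N\<close> but not on \<open>lam\<close>.\<close>

lemma bead_count_eq_content_count:
  assumes "length lam \<le> N"
  shows "bead_count p lam N k = content_count p lam k - content_count p lam (k + 1)
           + (\<Sum>i<N. of_bool (int p dvd - int i - 1 - k))"
proof -
  have row: "(\<Sum>j<l. of_bool (int p dvd int j - int i - k))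
      - (\<Sum>j<l. of_bool (int p dvd int j - int i - (k + 1)))
    = (of_bool (int p dvd int l - int i - 1 - k) - of_bool (int p dvd - int i - 1 - k) :: int)"
    for i l :: nat
    by (induction l) (auto simp: algebra_simps)
  have "content_count p lam k' = (\<Sum>i<N. \<Sum>j<part lam i. of_bool (int p dvd int j - int i - k'))" for k'
    unfolding content_count_def young_diagram_Sigma[OF assms]
    by (subst sum.Sigma) (auto simp: content_def intro!: sum.cong)
  then have "content_count p lam k - content_count p lam (k + 1) =
     (\<Sum>i<N. of_bool (int p dvd beta lam i - k) - of_bool (int p dvd - int i - 1 - k))"
    by (simp only: sum_subtractf[where A = "{..<N}", symmetric] row beta_def)
  then show ?thesis
    by (simp add: bead_count_def sum_subtractf)
qed

section \<open>Removing a rim hook preserves the bead counts\<close>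

text \<open>If two rim cells lay on one diagonal, the lower one would force the diagonal successor
  of the upper one into the diagram.\<close>

lemma inj_on_content_rim:
  assumes "is_partition lam"
  shows "inj_on content (rim lam)"
proof -
  have "False" if "(i, j) \<in> rim lam" "(i', j') \<in> rim lam" "content (i, j) = content (i', j')" "i < i'"
    for i j i' j'
  proof -
    have "Suc j \<le> j'" using that by (simp add: content_def)
    moreover have "part lam i' \<le> part lam (Suc i)"
      using that by (intro antimonoD[OF part_antimono[OF assms]]) simp
    ultimately show False using that by (auto simp: rim_def young_diagram_part)
  qed
  then show ?thesis
    by (intro inj_onI) (smt (verit) content_def linorder_neqE_nat of_nat_eq_iff prod.collapse)
qed

text \<open>A discrete intermediate value theorem: a step to an adjacent cell changes the content by
  exactly one.\<close>

lemma connected_contents_between: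
  assumes "(\<lambda>u v. u \<in> R \<and> v \<in> R \<and> cell_adjacent u v)\<^sup>*\<^sup>* x y" "x \<in> R"
    and "content x \<le> d \<and> d \<le> content y \<or> content y \<le> d \<and> d \<le> content x"
  shows "d \<in> content ` R"
  using assms
proof (induction arbitrary: d rule: rtranclp_induct)
  case base
  then show ?case by auto
next
  case (step y z)
  have "content z = content y + 1 \<or> content z = content y - 1"
    using step.hyps(2) by (auto simp: cell_adjacent_def content_def)
  then have "d = content z \<or> (content x \<le> d \<and> d \<le> content y \<or> content y \<le> d \<and> d \<le> content x)"
    using step.prems by auto
  then show ?case using step by blast
qed

text \<open>By connectedness the contents fill the whole range from their minimum to their maximum,
  and by injectivity there are \<open>p\<close> of them.\<close>

lemma rim_hook_contents:
  assumes "rim_hook_removal p lam R mu" "p > 0"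
  shows "\<exists>u. bij_betw content R {u..<u + int p}"
proof -
  have R: "R \<subseteq> rim lam" "cells_connected R" "card R = p" "is_partition lam"
    using assms by (auto simp: rim_hook_removal_def)
  have fin: "finite R" "R \<noteq> {}" using R(3) assms(2) card_gt_0_iff by fastforce+
  have inj: "inj_on content R"
    using inj_on_content_rim[OF R(4)] R(1) by (rule inj_on_subset)
  define T where "T = content ` R"
  have T: "finite T" "T \<noteq> {}" using fin by (auto simp: T_def)
  have "{Min T..Max T} \<subseteq> T"
  proof
    fix d assume d: "d \<in> {Min T..Max T}"
    obtain x y where xy: "x \<in> R" "y \<in> R" "content x = Min T" "content y = Max T"
      using Min_in[OF T] Max_in[OF T] unfolding T_def by (metis imageE)
    then have "(\<lambda>u v. u \<in> R \<and> v \<in> R \<and> cell_adjacent u v)\<^sup>*\<^sup>* x y"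
      using R(2) by (auto simp: cells_connected_def)
    then show "d \<in> T"
      using connected_contents_between[of R x y d] xy d by (auto simp: T_def)
  qed
  then have eq: "T = {Min T..Max T}" using T by auto
  have "card T = p" using R(3) inj by (simp add: T_def card_image)
  then have "Max T = Min T + int p - 1"
    using eq assms(2) by (smt (verit) card_atLeastAtMost_int nat_eq_iff2 not_gr_zero)
  moreover have "{u..u + int p - 1} = {u..<u + int p}" for u by auto
  ultimately have "T = {Min T..<Min T + int p}" using eq by metis
  then show ?thesis using inj unfolding T_def bij_betw_def by blast
qed

text \<open>The indicator of the multiples of \<open>p\<close> is the backward difference of the
  floor of \<open>x / p\<close>. Counting a residue class in a run of integers thus reduces to a
  difference of two floors.\<close>

lemma of_bool_dvd_eq_div_diff:
  assumes "p > 0"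
  shows "of_bool (int p dvd x) = x div int p - (x - 1) div int p"
proof (cases "int p dvd x")
  case True
  then obtain c where c: "x = int p * c" by blast
  have "(x - 1) div int p = c - 1"
    using assms unfolding c by (intro int_div_pos_eq[where r = "int p - 1"]) (auto simp: algebra_simps)
  then show ?thesis using c assms by simp
next
  case False
  define q r where "q = x div int p" and "r = x mod int p"
  have x: "x = int p * q + r" by (simp add: q_def r_def)
  have "r \<noteq> 0" "0 \<le> r" "r < int p"
    using False assms by (simp_all add: r_def dvd_eq_mod_eq_0)
  then have r: "0 < r" "r < int p" by simp_all
  have "(x - 1) div int p = q"
    using r unfolding x by (intro int_div_pos_eq[where r = "r - 1"]) auto
  then show ?thesis using False by (simp add: q_def)
qed

lemma sum_of_bool_dvd_interval:
  assumes "p > 0"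
  shows "(\<Sum>j<n. of_bool (int p dvd a + int j - k))
           = (a + int n - k - 1) div int p - (a - k - 1) div int p"
proof (induction n)
  case (Suc n)
  have "of_bool (int p dvd a + int n - k)
      = (a + int (Suc n) - k - 1) div int p - (a + int n - k - 1) div int p"
    by (simp add: of_bool_dvd_eq_div_diff[OF assms] algebra_simps)
  then show ?case unfolding sum.lessThan_Suc Suc.IH by linarith
qed simp

text \<open>Among \<open>p\<close> consecutive contents each residue occurs exactly once.\<close>

lemma content_count_rim_hook_removal:
  assumes "rim_hook_removal p lam R mu" "p > 0"
  shows "content_count p lam k = content_count p mu k + 1"
proof -
  have sub: "R \<subseteq> young_diagram lam" and mu: "young_diagram mu = young_diagram lam - R"
    using assms(1) by (auto simp: rim_hook_removal_def rim_def)
  obtain u where u: "bij_betw content R {u..<u + int p}"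
    using rim_hook_contents[OF assms] by blast
  have "bij_betw (\<lambda>j. u + int j) {..<p} {u..<u + int p}"
    by (rule bij_betw_byWitness[where f' = "\<lambda>x. nat (x - u)"]) auto
  then have "(\<Sum>x\<in>{u..<u + int p}. of_bool (int p dvd x - k))
      = (\<Sum>j<p. of_bool (int p dvd u + int j - k) :: int)"
    by (rule sum.reindex_bij_betw[symmetric])
  also have "\<dots> = (u - k - 1 + int p) div int p - (u - k - 1) div int p"
    by (simp add: sum_of_bool_dvd_interval[OF assms(2)] algebra_simps)
  also have "\<dots> = 1"
    using assms(2) by simp
  finally have "(\<Sum>z\<in>R. of_bool (int p dvd content z - k)) = (1 :: int)"
    using sum.reindex_bij_betw[OF u, of "\<lambda>x. of_bool (int p dvd x - k) :: int"] by simp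
  then show ?thesis
    unfolding content_count_def mu
    using sum.subset_diff[OF sub finite_young_diagram, of "\<lambda>z. of_bool (int p dvd content z - k) :: int"]
    by simp
qed

lemma content_count_diff_invariant:
  assumes "(removes_rim_hook p)\<^sup>*\<^sup>* lam mu" "p > 0"
  shows "content_count p lam k - content_count p lam (k + 1)
       = content_count p mu k - content_count p mu (k + 1)"
  using assms(1)
proof (induction rule: rtranclp_induct)
  case (step mu nu)
  then obtain R where "rim_hook_removal p mu R nu" by (auto simp: removes_rim_hook_def)
  from content_count_rim_hook_removal[OF this assms(2)] step.IH show ?case by simp
qed simp

lemma bead_count_invariant:
  assumes "(removes_rim_hook p)\<^sup>*\<^sup>* lam mu" "p > 0" "length lam \<le> N" "length mu \<le> N"
  shows "bead_count p lam N k = bead_count p mu N k"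
  using content_count_diff_invariant[OF assms(1,2), of k]
  by (simp add: bead_count_eq_content_count[OF assms(3)] bead_count_eq_content_count[OF assms(4)])

section \<open>A bead that can move yields a rim hook\<close>

text \<open>The equation for \<open>h\<close> says that the beta-number of row \<open>i\<close>,
  lowered by \<open>h\<close>, becomes \<open>v - q - 1\<close>, that of a row \<open>q\<close> of
  length \<open>v\<close>. The bounds on \<open>v\<close> place it strictly between the old
  beta-numbers of rows \<open>Suc q\<close> and \<open>q\<close>.\<close>

lemma removes_rim_hookI:
  assumes lam: "is_partition lam" and "i \<le> q"
    and v: "part lam (Suc q) \<le> v" "v < part lam q"
    and h: "v + h + i = part lam i + q"
  shows "\<exists>mu. removes_rim_hook h lam mu"
proof -
  \<comment> \<open>After the move, the beta-numbers of rows \<open>i + 1\<close> to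
    \<open>q\<close> belong to the rows one higher. Keeping the value while the row index drops by
    one costs one cell, hence \<open>part lam (Suc k) - 1\<close>.\<close>
  define f where "f k = (if k < i \<or> k > q then part lam k
    else if k < q then part lam (Suc k) - 1 else v)" for k
  define R where "R = {(k, j). f k \<le> j \<and> j < part lam k}"
  have anti: "part lam l \<le> part lam k" if "k \<le> l" for k l
    using antimonoD[OF part_antimono[OF lam] that] .
  have lt: "f k < part lam k" if "i \<le> k" "k \<le> q" for k
  proof (cases "k = q")
    case False
    then have "part lam q \<le> part lam (Suc k)" "part lam (Suc k) \<le> part lam k"
      using that by (auto intro!: anti)
    then show ?thesis using that v by (auto simp: f_def)
  qed (use that v in \<open>auto simp: f_def\<close>)
  have le: "f k \<le> part lam k" for k
    using lt[of k] by (cases "i \<le> k \<and> k \<le> q") (auto simp: f_def)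
  have "f (Suc k) \<le> f k" for k
  proof -
    consider "Suc k \<le> i" | "i \<le> k" "Suc k < q" | "i \<le> k" "Suc k = q" | "k = q" | "q < k"
      by linarith
    then show ?thesis
    proof cases
      case 1
      then show ?thesis
        using le[of "Suc k"] anti[of k "Suc k"] by (auto simp: f_def)
    next
      case 2
      then show ?thesis
        using anti[of "Suc k" "Suc (Suc k)"] by (auto simp: f_def)
    next
      case 3
      then show ?thesis using v by (auto simp: f_def)
    next
      case 4
      then show ?thesis using v \<open>i \<le> q\<close> by (auto simp: f_def)
    next
      case 5
      then show ?thesis using anti[of k "Suc k"] by (auto simp: f_def)
    qed
  qed
  then have "antimono f" by (simp add: antimono_iff_le_Suc)
  moreover have "f (length lam) = 0"
    using le[of "length lam"] by (simp add: part_eq_0)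
  ultimately obtain mu where mu: "is_partition mu" "young_diagram mu = {(k, j). j < f k}"
    using ex_partition_of_antimono by blast
  have R_Sigma: "R = (SIGMA k:{i..q}. {f k..<part lam k})"
    by (auto simp: R_def f_def split: if_splits)

  have "card R = h"
  proof -
    \<comment> \<open>A row \<open>k < q\<close> loses
      \<open>part lam k - part lam (Suc k) + 1\<close> cells, which telescopes; row \<open>q\<close>
      is added afterwards.\<close>
    have "(\<Sum>k=i..<n. int (part lam k - f k)) = int (part lam i) - int (part lam n) + int n - int i"
      if "i \<le> n" "n \<le> q" for n
      using that
    proof (induction n rule: dec_induct)
      case (step n)
      have "part lam q \<le> part lam (Suc n)" using step.prems by (auto intro: anti)
      then have "int (part lam n - f n) = int (part lam n) - int (part lam (Suc n)) + 1"
        using step v lt[of n] by (auto simp: f_def)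
      then show ?case using step by simp
    qed simp
    from this[OF \<open>i \<le> q\<close> order_refl]
    have "(\<Sum>k=i..q. int (part lam k - f k)) = int h"
      using \<open>i \<le> q\<close> v h by (simp add: f_def flip: atLeastLessThanSuc_atLeastAtMost)
    then have "int (\<Sum>k=i..q. part lam k - f k) = int h" by simp
    then have "(\<Sum>k=i..q. part lam k - f k) = h" by linarith
    then show ?thesis unfolding R_Sigma by simp
  qed

  moreover have "R \<subseteq> rim lam"
  proof
    fix z assume "z \<in> R"
    then obtain k j where z: "z = (k, j)" "i \<le> k" "k \<le> q" "f k \<le> j" "j < part lam k"
      unfolding R_Sigma by auto
    \<comment> \<open>In every row of the hook \<open>f k\<close> is at least
      \<open>part lam (Suc k) - 1\<close>, so the diagonal successor of a removed cell lies outside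
      the diagram.\<close>
    then have "part lam (Suc k) \<le> Suc j"
      using v by (auto simp: f_def split: if_splits)
    then show "z \<in> rim lam" using z by (auto simp: rim_def young_diagram_part)
  qed

  moreover have "cells_connected R"
  proof -
    define E where "E = (\<lambda>u v. u \<in> R \<and> v \<in> R \<and> cell_adjacent u v)"
    have row: "E\<^sup>*\<^sup>* (k, part lam k - 1) (k, j)" if "i \<le> k" "k \<le> q" "f k \<le> j" "j < part lam k" for k j
    proof -
      have "j \<le> part lam k - 1" using that by simp
      then show ?thesis
      proof (induction j rule: inc_induct)
        case (step n)
        have "E (k, Suc n) (k, n)"
          using step that by (auto simp: E_def R_Sigma cell_adjacent_def)
        then show ?case using step.IH by (rule rtranclp.rtrancl_into_rtrancl[rotated])
      qed simp
    qed
    \<comment> \<open>Consecutive rows are linked because the leftmost removed cell of row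
      \<open>k\<close> is directly above the last cell of row \<open>Suc k\<close>.\<close>
    have first: "E\<^sup>*\<^sup>* (i, part lam i - 1) (k, part lam k - 1)" if "i \<le> k" "k \<le> q" for k
      using that
    proof (induction k rule: dec_induct)
      case (step k)
      have pos: "part lam (Suc k) > 0" using lt[of "Suc k"] step by simp
      have fk: "f k = part lam (Suc k) - 1" using step by (simp add: f_def)
      have E1: "E\<^sup>*\<^sup>* (k, part lam k - 1) (k, part lam (Suc k) - 1)"
        using step lt[of k] fk by (intro row) auto
      have "E (k, part lam (Suc k) - 1) (Suc k, part lam (Suc k) - 1)"
        using step lt[of k] lt[of "Suc k"] fk pos
        by (auto simp: E_def R_Sigma cell_adjacent_def)
      with E1 step show ?case by (auto intro: rtranclp_trans)
    qed simp
    have from_first: "E\<^sup>*\<^sup>* (i, part lam i - 1) z" if "z \<in> R" for z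
      using that rtranclp_trans[OF first row] by (auto simp: R_Sigma)
    have "symp E" by (auto simp: symp_def E_def cell_adjacent_def)
    then have sym: "symp E\<^sup>*\<^sup>*" by (rule symp_rtranclp)
    have "E\<^sup>*\<^sup>* x y" if "x \<in> R" "y \<in> R" for x y
      using from_first[OF that(1)] from_first[OF that(2)] sympD[OF sym] rtranclp_trans by metis
    then show ?thesis by (simp add: cells_connected_def E_def)
  qed

  moreover have "young_diagram mu = young_diagram lam - R"
    using le by (auto simp: mu(2) R_def young_diagram_part[of lam] intro: less_le_trans)
  ultimately show ?thesis
    using lam mu(1) by (auto simp: removes_rim_hook_def rim_hook_removal_def)
qed

lemma beta_strict_antimono:
  assumes "is_partition lam" "i < j"
  shows "beta lam j < beta lam i"
  using antimonoD[OF part_antimono[OF assms(1)], of i j] assms(2) by (simp add: beta_def)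

text \<open>If the position \<open>p\<close> below a beta-number were vacant, moving that
  beta-number there would delete a rim hook of length \<open>p\<close>.\<close>

lemma core_beta_closed:
  assumes lam: "is_partition lam" and "p > 0" and core: "\<nexists>nu. removes_rim_hook p lam nu"
  shows "beta lam i - int p \<in> range (beta lam)"
proof (rule ccontr)
  define x where "x = beta lam i - int p"
  assume "beta lam i - int p \<notin> range (beta lam)"
  then have ne: "beta lam k \<noteq> x" for k unfolding x_def by (metis rangeI)
  \<comment> \<open>Row \<open>n\<close> is the first whose beta-number lies below the vacant
    position \<open>x\<close>, so the hook ends in the row \<open>q\<close> just before it.\<close>
  define n where "n = (LEAST n. beta lam n < x)"
  have "beta lam (length lam + nat (\<bar>x\<bar> + 1)) < x"
    by (simp add: beta_def part_eq_0)
  then have n: "beta lam n < x" unfolding n_def by (rule LeastI)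
  have less: "beta lam k > x" if "k < n" for k
    using that not_less_Least[of k] ne[of k] unfolding n_def by fastforce
  have "beta lam i > x" using \<open>p > 0\<close> by (simp add: x_def)
  then have "i < n"
    using n beta_strict_antimono[OF lam, of n i] by (cases n i rule: linorder_cases) auto
  then obtain q where q: "n = Suc q" "i \<le> q" by (cases n) auto
  \<comment> \<open>The length that gives row \<open>q\<close> the beta-number \<open>x\<close>; it
    is nonnegative because row \<open>Suc q\<close> already lies below \<open>x\<close>.\<close>
  define v where "v = nat (x + int q + 1)"
  have v: "int v = x + int q + 1"
    using n by (simp add: v_def q beta_def)
  have "\<exists>mu. removes_rim_hook p lam mu"
  proof (rule removes_rim_hookI[OF lam q(2)])
    show "part lam (Suc q) \<le> v" using n v by (simp add: q beta_def)
    show "v < part lam q" using less[of q] v by (simp add: q beta_def)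
    show "v + p + i = part lam i + q" using v by (simp add: x_def beta_def)
  qed
  with core show False by blast
qed

section \<open>Cores are determined by their bead counts\<close>

lemma bead_count_card:
  assumes "is_partition lam"
  shows "bead_count p lam N k = int (card {x \<in> beta lam ` {..<N}. int p dvd x - k})"
proof -
  have "inj (beta lam)"
    by (intro linorder_injI) (metis assms beta_strict_antimono less_irrefl)
  then have "card (beta lam ` {i \<in> {..<N}. int p dvd beta lam i - k})
      = card {i \<in> {..<N}. int p dvd beta lam i - k}"
    by (intro card_image) (rule inj_on_subset, auto)
  moreover have "{x \<in> beta lam ` {..<N}. int p dvd x - k} = beta lam ` {i \<in> {..<N}. int p dvd beta lam i - k}"
    by auto
  ultimately show ?thesis by (simp add: bead_count_def sum_of_bool_eq Int_def)
qed

text \<open>Beta-numbers strictly decrease, so sorting their set recovers the sequence.\<close>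

lemma part_eq_if_beta_image_eq:
  assumes "is_partition lam" "is_partition mu"
    and "beta lam ` {..<N} = beta mu ` {..<N}" "i < N"
  shows "part lam i = part mu i"
proof -
  have sorted: "sorted_wrt (<) (map (beta nu) (rev [0..<N]))" if "is_partition nu" for nu
    using beta_strict_antimono[OF that] by (auto simp: sorted_wrt_iff_nth_less rev_nth)
  have "map (beta lam) (rev [0..<N]) = map (beta mu) (rev [0..<N])"
    using assms sorted by (intro sorted_distinct_set_unique) (auto simp: strict_sorted_iff lessThan_atLeast0)
  then have "beta lam i = beta mu i" using assms(4) by auto
  then show ?thesis by (simp add: beta_def)
qed

text \<open>Within one residue class, the beta-numbers of a core that are at least
  \<open>- int N\<close> form an initial segment of the class. Two initial segments are nested, so a
  number \<open>x\<close> belonging to \<open>lam\<close> alone would make the counts in its class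
  differ.\<close>

lemma core_beta_subset:
  assumes lam: "is_partition lam" "\<nexists>nu. removes_rim_hook p lam nu" "length lam \<le> N"
    and mu: "is_partition mu" "\<nexists>nu. removes_rim_hook p mu nu" "length mu \<le> N"
    and "p > 0" and count: "\<And>k. bead_count p lam N k = bead_count p mu N k"
  shows "beta lam ` {..<N} \<subseteq> beta mu ` {..<N}"
proof (rule ccontr)
  have ge: "- int N \<le> x" if "x \<in> beta nu ` {..<N}" for x nu
    using that by (auto simp: beta_def)
  have closed: "x - int n * int p \<in> beta nu ` {..<N}"
    if "is_partition nu" "\<nexists>nu'. removes_rim_hook p nu nu'" "length nu \<le> N"
      "x \<in> beta nu ` {..<N}" "- int N \<le> x - int n * int p" for nu x n
    using that(5)
  proof (induction n)
    case (Suc n)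
    have "int p * int n \<le> int p * int (Suc n)" by (intro mult_left_mono) auto
    then have "- int N \<le> x - int n * int p" using Suc.prems by (simp add: algebra_simps)
    then obtain i where "x - int n * int p = beta nu i" using Suc.IH by auto
    then have "x - int (Suc n) * int p \<in> range (beta nu)"
      using core_beta_closed[OF that(1) \<open>p > 0\<close> that(2), of i] by (simp add: algebra_simps)
    then obtain k where k: "x - int (Suc n) * int p = beta nu k" by blast
    \<comment> \<open>A row with index at least \<open>N\<close> is empty, and its beta-number lies
      below \<open>- int N\<close>.\<close>
    then have "k < N" using Suc.prems that(3) by (cases "k < N") (auto simp: beta_def part_eq_0)
    then show ?case using k by auto
  qed (use that in simp)
  assume "\<not> ?thesis"
  then obtain x where x: "x \<in> beta lam ` {..<N}" "x \<notin> beta mu ` {..<N}" by blast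
  have "{y \<in> beta mu ` {..<N}. int p dvd y - x} \<subset> {y \<in> beta lam ` {..<N}. int p dvd y - x}"
  proof (intro psubsetI subsetI)
    fix y assume "y \<in> {y \<in> beta mu ` {..<N}. int p dvd y - x}"
    then have y: "y \<in> beta mu ` {..<N}" "int p dvd y - x" by auto
    then obtain c where c: "y - x = int p * c" by blast
    show "y \<in> {y \<in> beta lam ` {..<N}. int p dvd y - x}"
    \<comment> \<open>If \<open>y\<close> were at or above \<open>x\<close>, descending from
      \<open>y\<close> would put \<open>x\<close> among the numbers of \<open>mu\<close>. So
      \<open>y\<close> lies below \<open>x\<close> and is reached by descending from
      \<open>x\<close> in \<open>lam\<close>.\<close>
    proof (cases "c \<ge> 0")
      case True
      then have "x = y - int (nat c) * int p" using c by (simp add: algebra_simps)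
      then show ?thesis using closed[OF mu y(1), of "nat c"] ge[OF x(1)] x(2) by simp
    next
      case False
      then have "y = x - int (nat (- c)) * int p" using c by (simp add: algebra_simps)
      then show ?thesis using closed[OF lam x(1), of "nat (- c)"] ge[OF y(1)] y(2) by simp
    qed
  qed (use x in auto)
  then have "card {y \<in> beta mu ` {..<N}. int p dvd y - x} < card {y \<in> beta lam ` {..<N}. int p dvd y - x}"
    by (intro psubset_card_mono) auto
  then show False
    using count[of x] lam(1) mu(1) by (simp add: bead_count_card)
qed

lemma core_eqI:
  assumes "is_partition lam" "\<nexists>nu. removes_rim_hook p lam nu" "length lam \<le> N"
    and "is_partition mu" "\<nexists>nu. removes_rim_hook p mu nu" "length mu \<le> N"
    and "p > 0" and "\<And>k. bead_count p lam N k = bead_count p mu N k"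
  shows "lam = mu"
proof (rule partition_eqI)
  have "beta lam ` {..<N} = beta mu ` {..<N}"
    using core_beta_subset[of lam p N mu] core_beta_subset[of mu p N lam] assms by auto
  then show "part lam i = part mu i" for i
    using part_eq_if_beta_image_eq[of lam mu N i] assms
    by (cases "i < N") (auto simp: part_eq_0)
qed (use assms in auto)

section \<open>Existence of cores and identification of \<open>p_core\<close>\<close>

lemma ex_core:
  assumes "p > 0"
  shows "\<exists>mu. is_p_core_of p lam mu"
proof (induction "card (young_diagram lam)" arbitrary: lam rule: less_induct)
  case less
  show ?case
  proof (cases "\<exists>nu. removes_rim_hook p lam nu")
    case True
    then obtain nu R where nu: "rim_hook_removal p lam R nu"
      by (auto simp: removes_rim_hook_def)
    \<comment> \<open>As \<open>p > 0\<close>, a hook has at least one cell, so each removal shrinks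
      the diagram.\<close>
    have "R \<noteq> {}" "R \<subseteq> young_diagram lam" "young_diagram nu = young_diagram lam - R"
      using nu assms by (auto simp: rim_hook_removal_def rim_def)
    then have "card (young_diagram nu) < card (young_diagram lam)"
      by (intro psubset_card_mono finite_young_diagram) auto
    then obtain mu where "is_p_core_of p nu mu" using less by blast
    moreover have "removes_rim_hook p lam nu" using nu by (auto simp: removes_rim_hook_def)
    ultimately have "is_p_core_of p lam mu"
      by (auto simp: is_p_core_of_def intro: converse_rtranclp_into_rtranclp)
    then show ?thesis by blast
  qed (auto simp: is_p_core_of_def)
qed

lemma is_partition_of_removes_rim_hook:
  assumes "(removes_rim_hook p)\<^sup>*\<^sup>* lam mu" "is_partition lam"
  shows "is_partition mu"
  using assms by (induction rule: rtranclp_induct) (auto simp: removes_rim_hook_def rim_hook_removal_def)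

text \<open>The counts are compared for all \<open>N\<close> beyond a bound \<open>M\<close>, since
  \<open>N\<close> must also exceed the length of whichever core \<open>nu\<close> of
  \<open>lam\<close> is being compared with \<open>mu\<close>.\<close>

lemma p_core_eqI:
  assumes "p > 0" "is_partition lam" "is_partition mu" "\<nexists>nu. removes_rim_hook p mu nu"
    and count: "\<And>N k. M \<le> N \<Longrightarrow> bead_count p lam N k = bead_count p mu N k"
  shows "p_core p lam = mu"
proof -
  have unique: "nu = mu" if "is_p_core_of p lam nu" for nu
  proof -
    define N where "N = M + length lam + length mu + length nu"
    have nu: "(removes_rim_hook p)\<^sup>*\<^sup>* lam nu" "\<nexists>nu'. removes_rim_hook p nu nu'"
      using that by (auto simp: is_p_core_of_def)
    have "bead_count p nu N k = bead_count p mu N k" for k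
      using bead_count_invariant[OF nu(1) assms(1), of N k] count[of N k] by (simp add: N_def)
    then show ?thesis
      using is_partition_of_removes_rim_hook[OF nu(1) assms(2)] nu(2) assms
      by (intro core_eqI[of nu p N mu]) (auto simp: N_def)
  qed
  obtain nu where "is_p_core_of p lam nu" using ex_core[OF assms(1)] by blast
  with unique show ?thesis
    unfolding p_core_def by (intro the_equality) auto
qed

section \<open>Rectangles\<close>

lemma is_partition_rect: "is_partition (rect_partition c b)"
  by (auto simp: is_partition_def rect_partition_def sorted_wrt_iff_nth_less)

lemma part_rect: "part (rect_partition c b) i = (if i < b then c else 0)"
  by (simp add: part_def rect_partition_def)

text \<open>The rim of a nonempty rectangle is its last row together with its last column,
  \<open>b + c - 1\<close> cells in all.\<close>

lemma rect_is_core: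
  assumes "b + c \<le> p" "p > 0"
  shows "\<nexists>nu. removes_rim_hook p (rect_partition c b) nu"
proof
  assume "\<exists>nu. removes_rim_hook p (rect_partition c b) nu"
  then obtain R where R: "R \<subseteq> rim (rect_partition c b)" "card R = p"
    by (auto simp: removes_rim_hook_def rim_hook_removal_def)
  have sub: "rim (rect_partition c b) \<subseteq> {b - 1} \<times> {..<c} \<union> {..<b - 1} \<times> {c - 1}"
    by (auto simp: rim_def young_diagram_part part_rect split: if_splits)
  \<comment> \<open>With \<open>b = 0\<close> the truncated \<open>b - 1\<close> would only give the
    bound \<open>c\<close>, which may equal \<open>p\<close>; but then the rim is empty.\<close>
  have "b > 0" using R sub \<open>p > 0\<close>
    by (auto simp: rim_def young_diagram_part part_rect intro: Nat.gr0I)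
  have "card R \<le> card ({b - 1} \<times> {..<c} \<union> {..<b - 1} \<times> {c - 1})"
    using R sub by (intro card_mono) auto
  also have "\<dots> \<le> c + (b - 1)"
    by (rule order_trans[OF card_Un_le]) (simp add: card_cartesian_product)
  finally show False using R(2) assms \<open>b > 0\<close> by linarith
qed

text \<open>Rows of equal length \<open>c\<close> have consecutive descending beta-numbers. This
  serves for blocks of equal parts and, with \<open>c = 0\<close>, for the empty rows.\<close>

lemma sum_of_bool_dvd_lower_interval:
  assumes "p > 0" "m \<le> N"
  shows "(\<Sum>i=m..<N. of_bool (int p dvd c - int i - 1 - k))
           = (c - int m - k - 1) div int p - (c - int N - k - 1) div int p"
  using assms(2)
proof (induction N rule: dec_induct)
  case (step N)
  have "of_bool (int p dvd c - int N - 1 - k)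
      = (c - int N - k - 1) div int p - (c - int (Suc N) - k - 1) div int p"
    by (simp add: of_bool_dvd_eq_div_diff[OF assms(1)] algebra_simps)
  then show ?case
    unfolding sum.atLeastLessThan_Suc[OF step.hyps(1)] step.IH by linarith
qed simp

lemma bead_count_split:
  assumes "p > 0" "m \<le> N" "\<And>i. m \<le> i \<Longrightarrow> part lam i = 0"
  shows "bead_count p lam N k = bead_count p lam m k
           + ((- int m - k - 1) div int p - (- int N - k - 1) div int p)"
proof -
  have "bead_count p lam N k = bead_count p lam m k
      + (\<Sum>i=m..<N. of_bool (int p dvd beta lam i - k))"
    unfolding bead_count_def using assms(2)
    by (metis (no_types) sum.atLeastLessThan_concat atLeast0LessThan le0)
  also have "(\<Sum>i=m..<N. of_bool (int p dvd beta lam i - k) :: int)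
      = (\<Sum>i=m..<N. of_bool (int p dvd - int i - 1 - k))"
    using assms(3) by (intro sum.cong) (auto simp: beta_def)
  finally show ?thesis
    using sum_of_bool_dvd_lower_interval[OF assms(1,2), of 0 k] by simp
qed

lemma bead_count_rect:
  assumes "p > 0" "b \<le> N"
  shows "bead_count p (rect_partition c b) N k
    = (int c - k - 1) div int p - (int c - int b - k - 1) div int p
       + ((- int b - k - 1) div int p - (- int N - k - 1) div int p)"
proof -
  have "bead_count p (rect_partition c b) b k
      = (\<Sum>i<b. of_bool (int p dvd int c - int i - 1 - k))"
    unfolding bead_count_def by (intro sum.cong) (auto simp: beta_def part_rect)
  also have "\<dots> = (int c - k - 1) div int p - (int c - int b - k - 1) div int p"
    using sum_of_bool_dvd_lower_interval[OF assms(1), of 0 b "int c" k]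
    by (simp add: atLeast0LessThan)
  finally show ?thesis
    using bead_count_split[OF assms, of "rect_partition c b" k] by (simp add: part_rect)
qed

section \<open>JS-partitions\<close>

text \<open>Splits off all copies of the largest part, for induction over blocks;
  \<open>Suc a\<close> records that the block is nonempty.\<close>

lemma partition_first_block:
  assumes "is_partition lam" "lam \<noteq> []"
  obtains l a mu where "lam = replicate (Suc a) l @ mu" "l \<notin> set mu" "is_partition mu"
proof -
  define l where "l = hd lam"
  define xs mu where "xs = takeWhile (\<lambda>x. x = l) lam" and "mu = dropWhile (\<lambda>x. x = l) lam"
  have lam: "lam = xs @ mu" by (simp add: xs_def mu_def)
  have "xs = replicate (length xs) l"
    by (rule replicate_eqI) (auto simp: xs_def dest: set_takeWhileD)
  moreover have "length xs = Suc (length xs - 1)"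
    using assms(2) by (cases lam) (auto simp: xs_def l_def)
  ultimately obtain a where xs: "xs = replicate (Suc a) l" by metis
  have mu: "is_partition mu"
    using assms(1) unfolding lam by (auto simp: is_partition_def sorted_wrt_append)
  have "l \<notin> set mu"
  proof
    assume l: "l \<in> set mu"
    then have ne: "mu \<noteq> []" by auto
    then have "hd mu \<noteq> l" using hd_dropWhile[of "\<lambda>x. x = l" lam] by (auto simp: mu_def)
    moreover have "hd mu \<le> l" using assms(1) ne xs unfolding lam
      by (auto simp: is_partition_def sorted_wrt_append)
    moreover have "l \<le> hd mu" using mu l by (cases mu) (auto simp: is_partition_def)
    ultimately show False by simp
  qed
  with that lam xs mu show ?thesis by blast
qed

lemma remdups_replicate_append:
  "x \<notin> set xs \<Longrightarrow> remdups (replicate (Suc a) x @ xs) = x # remdups xs"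
  by (induction a) auto

lemma count_list_replicate: "count_list (replicate n x) y = (if x = y then n else 0)"
  by (induction n) auto

lemma hd_remdups_partition:
  assumes "is_partition lam" "lam \<noteq> []"
  shows "remdups lam ! 0 = hd lam"
proof -
  obtain l a mu where "lam = replicate (Suc a) l @ mu" "l \<notin> set mu"
    using partition_first_block[OF assms] by metis
  then have "remdups lam = l # remdups mu" "hd lam = l"
    using remdups_replicate_append[of l mu a] by simp_all
  then show ?thesis by simp
qed

text \<open>Dropping the first block shifts the indices of the distinct parts by one and keeps the
  other multiplicities. The condition at index 0 becomes the congruence linking the two
  blocks.\<close>

lemma js_partition_block:
  assumes js: "js_partition p (replicate (Suc a) l @ mu)" and l: "l \<notin> set mu" and mu: "is_partition mu"
  shows "js_partition p mu"
    and "mu \<noteq> [] \<Longrightarrow>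
      [int l - int (hd mu) + int (Suc a) + int (count_list mu (hd mu)) = 0] (mod int p)"
proof -
  let ?lam = "replicate (Suc a) l @ mu"
  note rd = remdups_replicate_append[OF l, of a]
  have cl: "count_list ?lam l = Suc a"
    using l by (simp add: count_list_replicate count_list_0_iff del: replicate_Suc)
  have c: "count_list ?lam x = count_list mu x" if "x \<in> set mu" for x
    using that l by (auto simp: count_list_replicate simp del: replicate_Suc)
  have step: "[int (remdups ?lam ! i) - int (remdups ?lam ! Suc i)
      + int (count_list ?lam (remdups ?lam ! i)) + int (count_list ?lam (remdups ?lam ! Suc i)) = 0] (mod int p)"
    if "Suc i < length (remdups ?lam)" for i
    using js that by (simp add: js_partition_def Let_def del: replicate_Suc)
  have reg: "p_regular p mu"
    using js mu c by (fastforce simp: js_partition_def p_regular_def simp del: replicate_Suc)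
  have mem: "remdups mu ! i \<in> set mu" if "i < length (remdups mu)" for i
    using nth_mem[OF that] by simp
  show "js_partition p mu"
    unfolding js_partition_def Let_def
  proof (intro conjI reg allI impI)
    fix i assume i: "Suc i < length (remdups mu)"
    then have "Suc (Suc i) < length (remdups ?lam)" by (simp add: rd del: replicate_Suc)
    from step[OF this] c[OF mem[of i]] c[OF mem[OF i]] i
    show "[int (remdups mu ! i) - int (remdups mu ! Suc i) + int (count_list mu (remdups mu ! i))
        + int (count_list mu (remdups mu ! Suc i)) = 0] (mod int p)"
      by (simp add: rd del: replicate_Suc)
  qed
  assume ne: "mu \<noteq> []"
  then have "Suc 0 < length (remdups ?lam)" by (simp add: rd del: replicate_Suc)
  from step[OF this] hd_remdups_partition[OF mu ne] c[of "hd mu"] cl ne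
  show "[int l - int (hd mu) + int (Suc a) + int (count_list mu (hd mu)) = 0] (mod int p)"
    by (simp add: rd del: replicate_Suc of_nat_Suc count_list_append)
qed

text \<open>The first block occupies the run from \<open>l - b\<close> to \<open>l - 1\<close>,
  where \<open>l\<close> is the largest part and \<open>b\<close> its multiplicity. By induction the
  remaining beta-numbers form, modulo \<open>p\<close>, one run, and the congruence makes it start
  at \<open>l\<close>, so the two runs join.\<close>

lemma sum_beads_js_partition:
  assumes "js_partition p lam" "lam \<noteq> []" "p > 0"
  shows "(\<Sum>i<length lam. of_bool (int p dvd int (lam ! i) - int i - 1 - k))
    = (int (hd lam) - int (count_list lam (hd lam)) + int (length lam) - k - 1) div int p
      - (int (hd lam) - int (count_list lam (hd lam)) - k - 1) div int p"
  using assms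
proof (induction "length lam" arbitrary: lam k rule: less_induct)
  case less
  \<comment> \<open>\<open>F y - F x\<close> counts the integers congruent to \<open>k\<close> from
    \<open>x\<close> up to \<open>y - 1\<close>.\<close>
  define F where "F x = (x - k - 1) div int p" for x
  have "is_partition lam" using less.prems by (simp add: js_partition_def p_regular_def)
  then obtain l a mu where lam: "lam = replicate (Suc a) l @ mu" "l \<notin> set mu" "is_partition mu"
    using less.prems(2) partition_first_block by metis
  define b where "b = Suc a"
  have hd: "hd lam = l" by (simp add: lam(1))
  have cl: "count_list lam l = b"
    using lam by (simp add: count_list_replicate count_list_0_iff b_def del: replicate_Suc)
  have len: "length lam = b + length mu" by (simp add: lam b_def)
  have split: "(\<Sum>i<b + n. g i) = (\<Sum>i<b. g i) + (\<Sum>i<n. g (b + i))" for g :: "nat \<Rightarrow> int" and n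
    by (induction n) (auto simp: add.assoc)
  have "(\<Sum>i<b. of_bool (int p dvd int (lam ! i) - int i - 1 - k) :: int)
      = (\<Sum>i<b. of_bool (int p dvd int l - int i - 1 - k))"
    by (intro sum.cong) (auto simp: lam(1) b_def nth_append simp del: replicate_Suc)
  also have "\<dots> = F (int l) - F (int l - int b)"
    using sum_of_bool_dvd_lower_interval[OF less.prems(3), of 0 b "int l" k]
    by (simp add: atLeast0LessThan F_def)
  finally have first: "(\<Sum>i<b. of_bool (int p dvd int (lam ! i) - int i - 1 - k))
      = F (int l) - F (int l - int b)" .
  \<comment> \<open>Inside \<open>lam\<close> the rows of \<open>mu\<close> sit \<open>b\<close>
    places lower. The shift is absorbed into the residue, which is why \<open>k\<close> varies in
    the induction.\<close>
  have "(\<Sum>i<length mu. of_bool (int p dvd int (lam ! (b + i)) - int (b + i) - 1 - k) :: int)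
      = (\<Sum>i<length mu. of_bool (int p dvd int (mu ! i) - int i - 1 - (k + int b)))"
    by (intro sum.cong) (auto simp: lam(1) b_def nth_append algebra_simps simp del: replicate_Suc)
  also have "\<dots> = F (int l + int (length mu)) - F (int l)"
  proof (cases "mu = []")
    case False
    define h where "h = int (hd mu) - int (count_list mu (hd mu))"
    have js: "js_partition p mu"
      and "[int l - int (hd mu) + int b + int (count_list mu (hd mu)) = 0] (mod int p)"
      using js_partition_block[of p a l mu] less.prems(1) lam False by (auto simp only: b_def)
    \<comment> \<open>The run of \<open>mu\<close> starts at \<open>h\<close>, hence
      \<open>b\<close> lower inside \<open>lam\<close>; modulo \<open>p\<close> this is
      \<open>l\<close>.\<close>
    then have "int p dvd int l + int b - h"
      by (simp add: cong_0_iff h_def algebra_simps)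
    then obtain t where "int l + int b - h = int p * t" by blast
    then have t: "h = int l + int b - int p * t" by simp
    have "(\<Sum>i<length mu. of_bool (int p dvd int (mu ! i) - int i - 1 - (k + int b)))
        = (h + int (length mu) - (k + int b) - 1) div int p - (h - (k + int b) - 1) div int p"
      unfolding h_def using len by (intro less.hyps[OF _ js False less.prems(3)]) (simp add: b_def)
    also have "h + int (length mu) - (k + int b) - 1 = int l + int (length mu) - k - 1 + int p * (- t)"
      by (simp add: t)
    also have "h - (k + int b) - 1 = int l - k - 1 + int p * (- t)"
      by (simp add: t)
    finally show ?thesis
      using less.prems(3) by (simp only: F_def div_mult_self2)
  qed simp
  finally show ?case
    unfolding len split first hd cl by (simp add: F_def algebra_simps)
qed

text \<open>Replacing the start of the run and the number of parts by their residues changes the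
  numerators by multiples of \<open>p\<close>. The change of start cancels between the first two
  floors. The change of length adds \<open>q\<close> to the first floor and removes \<open>q\<close>
  from that of the empty rows.\<close>

lemma bead_count_js_partition:
  assumes "js_partition p lam" "p > 0" "[length lam = r] (mod p)" "r < p" "length lam \<le> N"
  shows "bead_count p lam N k
    = (int (js_type p lam + r) - k - 1) div int p - (int (js_type p lam) - k - 1) div int p
      + ((- int r - k - 1) div int p - (- int N - k - 1) div int p)"
proof -
  define q where "q = int (length lam div p)"
  have "length lam mod p = r" using assms(3,4) by (simp add: cong_def)
  then have m: "int (length lam) = int r + int p * q"
    unfolding q_def by (metis mult_div_mod_eq add.commute of_nat_add of_nat_mult)
  have shift: "(x + int p * c) div int p = x div int p + c" for x c
    using assms(2) by simp
  have own: "bead_count p lam (length lam) k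
      = (int (js_type p lam) + int (length lam) - k - 1) div int p - (int (js_type p lam) - k - 1) div int p"
  proof (cases "lam = []")
    case False
    define h where "h = int (hd lam) - int (count_list lam (hd lam))"
    have "int (js_type p lam) = h mod int p"
      using False assms(2) by (simp add: js_type_def h_def)
    then have h: "h = int (js_type p lam) + int p * (h div int p)" by simp
    have "bead_count p lam (length lam) k
        = (\<Sum>i<length lam. of_bool (int p dvd int (lam ! i) - int i - 1 - k))"
      unfolding bead_count_def by (intro sum.cong) (auto simp: beta_def part_def)
    also have "\<dots> = (h + int (length lam) - k - 1) div int p - (h - k - 1) div int p"
      unfolding h_def by (rule sum_beads_js_partition[OF assms(1) False assms(2)])
    also have "h + int (length lam) - k - 1
        = int (js_type p lam) + int (length lam) - k - 1 + int p * (h div int p)"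
      using h by linarith
    also have "h - k - 1 = int (js_type p lam) - k - 1 + int p * (h div int p)"
      using h by linarith
    finally show ?thesis by (simp only: shift)
  qed (simp add: bead_count_def)
  have up: "int (js_type p lam) + int (length lam) - k - 1 = int (js_type p lam + r) - k - 1 + int p * q"
    by (simp add: m)
  have down: "- int (length lam) - k - 1 = - int r - k - 1 + int p * (- q)"
    by (simp add: m)
  have "bead_count p lam N k = bead_count p lam (length lam) k
      + ((- int (length lam) - k - 1) div int p - (- int N - k - 1) div int p)"
    using bead_count_split[OF assms(2,5)] part_eq_0 by blast
  then show ?thesis
    unfolding own up down shift by simp
qed

text \<open>Reduces each case to a floor identity: the terms in \<open>N\<close> agree on both sides
  and cancel.\<close>

lemma p_core_js_partition_eq_rect:
  assumes js: "js_partition p lam" and "p > 0" and r: "[length lam = r] (mod p)" "r < p"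
    and bc: "b + c \<le> p"
    and eq: "\<And>k. (int c - k) div int p - (int c - int b - k) div int p + (- int b - k) div int p
      = (int (js_type p lam + r) - k) div int p - (int (js_type p lam) - k) div int p
        + (- int r - k) div int p"
  shows "p_core p lam = rect_partition c b"
\<comment> \<open>This bound covers the rows of \<open>lam\<close> and, as \<open>b\<close> is at
  most \<open>p\<close>, those of the rectangle.\<close>
proof (rule p_core_eqI[where M = "length lam + p"])
  show "is_partition lam" using js by (simp add: js_partition_def p_regular_def)
  fix N k assume N: "length lam + p \<le> N"
  show "bead_count p lam N k = bead_count p (rect_partition c b) N k"
    \<comment> \<open>The count formulas have numerators ending in \<open>- k - 1\<close>, while
      \<open>eq\<close> is stated with \<open>- k\<close>.\<close>
    using eq[of "k + 1"] N bc bead_count_js_partition[OF js \<open>p > 0\<close> r, of N k]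
      bead_count_rect[OF \<open>p > 0\<close>, of b N c k]
    by (simp add: algebra_simps)
qed (use \<open>p > 0\<close> bc is_partition_rect rect_is_core in auto)

section \<open>The four ranges of \<open>r\<close>\<close>

theorem theorem3p6:
  fixes p \<alpha> r :: nat and lam :: "nat list"
  assumes "p \<ge> 2"
    and "js_partition p lam"
    and "\<alpha> \<in> {0..p - 1}" and "js_type p lam = \<alpha>"
    and "r \<in> {0..p - 1}" and "[length lam = r] (mod p)"
  shows
    "(real r \<le> (real p - real \<alpha>) / 2 \<longrightarrow>
        (let s = r in p_core p lam = rect_partition (\<alpha> + s) s)) \<and>
     ((real p - real \<alpha>) / 2 < real r \<and> r \<le> p - \<alpha> \<longrightarrow>
        (let s = (p - \<alpha>) - r in p_core p lam = rect_partition (\<alpha> + s) s)) \<and>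
     (p - \<alpha> < r \<and> real r \<le> real p - real \<alpha> / 2 \<longrightarrow>
        (let s = r - (p - \<alpha>) in p_core p lam = rect_partition s (p - \<alpha> + s))) \<and>
     (real p - real \<alpha> / 2 < real r \<and> r < p \<longrightarrow>
        (let s = p - r in p_core p lam = rect_partition s (p - \<alpha> + s)))"
proof -
  have p: "p > 0" and \<alpha>: "\<alpha> < p" and r: "r < p" using assms by auto
  have shift: "(x + int p * c) div int p = x div int p + c" for x c
    using p by simp
  note core = p_core_js_partition_eq_rect[OF assms(2) p assms(6) r, unfolded assms(4)]
  have "p_core p lam = rect_partition (\<alpha> + r) r" if "real r \<le> (real p - real \<alpha>) / 2"
  proof (rule core)
    \<comment> \<open>The bound on \<open>r\<close> says exactly that rows plus columns do not
      exceed \<open>p\<close>. The floor identity is trivial here, both sides being equal term by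
      term.\<close>
    show "r + (\<alpha> + r) \<le> p" using that by (simp add: field_simps)
  qed simp
  moreover have "p_core p lam = rect_partition (\<alpha> + (p - \<alpha> - r)) (p - \<alpha> - r)"
    if "(real p - real \<alpha>) / 2 < real r" "r \<le> p - \<alpha>"
  proof (rule core)
    show "p - \<alpha> - r + (\<alpha> + (p - \<alpha> - r)) \<le> p" using that \<alpha> by (simp add: field_simps)
    fix k
    \<comment> \<open>Modulo \<open>p\<close> the first and last numerators trade places; the
      resulting shifts \<open>+1\<close> and \<open>-1\<close> of the floors cancel.\<close>
    have "int (\<alpha> + (p - \<alpha> - r)) - k = - int r - k + int p * 1"
      "int (\<alpha> + (p - \<alpha> - r)) - int (p - \<alpha> - r) - k = int \<alpha> - k"
      "- int (p - \<alpha> - r) - k = int (\<alpha> + r) - k + int p * (- 1)"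
      using that \<alpha> by auto
    then show "(int (\<alpha> + (p - \<alpha> - r)) - k) div int p
        - (int (\<alpha> + (p - \<alpha> - r)) - int (p - \<alpha> - r) - k) div int p + (- int (p - \<alpha> - r) - k) div int p
      = (int (\<alpha> + r) - k) div int p - (int \<alpha> - k) div int p + (- int r - k) div int p"
      by (simp only: shift)
  qed
  moreover have "p_core p lam = rect_partition (r - (p - \<alpha>)) (p - \<alpha> + (r - (p - \<alpha>)))"
    if "p - \<alpha> < r" "real r \<le> real p - real \<alpha> / 2"
  proof (rule core)
    show "p - \<alpha> + (r - (p - \<alpha>)) + (r - (p - \<alpha>)) \<le> p" using that \<alpha> by (simp add: field_simps)
    fix k
    \<comment> \<open>The first two numerators both drop by \<open>p\<close>, and their floors enter
      with opposite signs.\<close>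
    have "int (r - (p - \<alpha>)) - k = int (\<alpha> + r) - k + int p * (- 1)"
      "int (r - (p - \<alpha>)) - int (p - \<alpha> + (r - (p - \<alpha>))) - k = int \<alpha> - k + int p * (- 1)"
      "- int (p - \<alpha> + (r - (p - \<alpha>))) - k = - int r - k"
      using that \<alpha> by auto
    then show "(int (r - (p - \<alpha>)) - k) div int p
        - (int (r - (p - \<alpha>)) - int (p - \<alpha> + (r - (p - \<alpha>))) - k) div int p
        + (- int (p - \<alpha> + (r - (p - \<alpha>))) - k) div int p
      = (int (\<alpha> + r) - k) div int p - (int \<alpha> - k) div int p + (- int r - k) div int p"
      by (simp only: shift)
  qed
  moreover have "p_core p lam = rect_partition (p - r) (p - \<alpha> + (p - r))"
    if "real p - real \<alpha> / 2 < real r"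
  proof (rule core)
    show "p - \<alpha> + (p - r) + (p - r) \<le> p" using that \<alpha> r by (simp add: field_simps)
    fix k
    \<comment> \<open>The first and last numerators trade places again. The floors shift by
      \<open>+1\<close>, \<open>-1\<close> and \<open>-2\<close>, and the middle one is subtracted,
      so the total is 0.\<close>
    have "int (p - r) - k = - int r - k + int p * 1"
      "int (p - r) - int (p - \<alpha> + (p - r)) - k = int \<alpha> - k + int p * (- 1)"
      "- int (p - \<alpha> + (p - r)) - k = int (\<alpha> + r) - k + int p * (- 2)"
      using \<alpha> r by auto
    then show "(int (p - r) - k) div int p
        - (int (p - r) - int (p - \<alpha> + (p - r)) - k) div int p
        + (- int (p - \<alpha> + (p - r)) - k) div int p
      = (int (\<alpha> + r) - k) div int p - (int \<alpha> - k) div int p + (- int r - k) div int p"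
      by (simp only: shift)
  qed
  ultimately show ?thesis by (simp add: Let_def)
qed

end
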